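(* Let $M$ be a monoid (i.e., a cancellative commutative semigroup with identity). The following conditions are equivalent. (a) Every submonoid of $M$ is a half-factorial monoid (HFM). (b) Every undermonoid of $M$ is an HFM. (c) $M$ is a group and each element of $M$ has finite order.
   Context: "Monoid" means a cancellative and commutative semigroup with identity, written additively. $\mathcal{U}(M)$ is the group of invertible elements of $M$. $\operatorname{gp}(M)$ is the Grothendieck group of $M$ (the group of differences $\{x-y : x,y\in M\}$, in which $M$ embeds); the order of an element of $M$ is its order in $\operatorname{gp}(M)$. A submonoid $N$ of $M$ is an undermonoid of $M$ if $\operatorname{gp}(N)=\operatorname{gp}(M)$, where $\operatorname{gp}(N)$ is identified with the subgroup of $\operatorname{gp}(M)$ generated by $N$. An atom of a monoid $M$ is an element $a\in M\setminus\mathcal{U}(M)$ such that whenever $a=b+c$ with $b,c\in M$, either $b\in\mathcal{U}(M)$ or $c\in\mathcal{U}(M)$; $\mathcal{A}(M)$ is the set of atoms of $M$. $M$ is atomic if every element of $M$ is invertible or a sum of finitely many atoms. For a monoid $M$, let $\mathsf{Z}(M)$ be the free commutative monoid on $\mathcal{A}(M/\mathcal{U}(M))$, and let $\phi\colon\mathsf{Z}(M)\to M/\mathcal{U}(M)$ be the monoid homomorphism that is the identity on $\mathcal{A}(M/\mathcal{U}(M))$. For $b\in M$, set $\mathsf{Z}(b)=\phi^{-1}(b+\mathcal{U}(M))$ and $\mathsf{L}(b)=\{|z| : z\in\mathsf{Z}(b)\}$, where $|z|$ is the number of atoms in the formal sum $z$ counted with multiplicity (the empty sum, which is the only factorization of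 an invertible element, has length $0$). $M$ is a half-factorial monoid (HFM) if it is atomic and $|\mathsf{L}(b)|=1$ for all $b\in M$. *)

theory Defs
  imports
    "HOL-Algebra.Divisibility"
    "HOL-Algebra.Coset"
    "HOL-Algebra.Generated_Groups"
    "HOL-Algebra.Multiplicative_Group"
    "HOL-Library.Multiset"
begin

text \<open>
  A ``monoid'' (commutative, cancellative, with identity) is a \<^locale>\<open>comm_monoid_cancel\<close>.
  HOL-Algebra writes monoids multiplicatively, so a sum \<open>b + c\<close> appears as \<open>b \<otimes> c\<close>. A submonoid
  \<open>N\<close> of \<open>M\<close>, seen as a monoid of its own, is \<open>M\<lparr>carrier := N\<rparr>\<close>.
\<close>

subsection \<open>The Grothendieck group\<close>

text \<open>The pair \<open>(a, b)\<close> stands for the difference \<open>a - b\<close>; as \<open>M\<close> is cancellative, no stabilizing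
  summand is needed in the relation.\<close>

definition diff_rel :: "('a, 'm) monoid_scheme \<Rightarrow> (('a \<times> 'a) \<times> ('a \<times> 'a)) set" where
  "diff_rel M = {((a, b), (c, d)) | a b c d.
     a \<in> carrier M \<and> b \<in> carrier M \<and> c \<in> carrier M \<and> d \<in> carrier M \<and>
     a \<otimes>\<^bsub>M\<^esub> d = c \<otimes>\<^bsub>M\<^esub> b}"

definition gp :: "('a, 'm) monoid_scheme \<Rightarrow> ('a \<times> 'a) set monoid" where
  "gp M = \<lparr>carrier = (carrier M \<times> carrier M) // diff_rel M,
     monoid.mult = (\<lambda>X Y. \<Union>(a, b) \<in> X. \<Union>(c, d) \<in> Y. diff_rel M `` {(a \<otimes>\<^bsub>M\<^esub> c, b \<otimes>\<^bsub>M\<^esub> d)}),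
     one = diff_rel M `` {(\<one>\<^bsub>M\<^esub>, \<one>\<^bsub>M\<^esub>)}\<rparr>"

definition gp_embed :: "('a, 'm) monoid_scheme \<Rightarrow> 'a \<Rightarrow> ('a \<times> 'a) set" where
  "gp_embed M x = diff_rel M `` {(x, \<one>\<^bsub>M\<^esub>)}"

definition finite_order :: "('a, 'm) monoid_scheme \<Rightarrow> 'a \<Rightarrow> bool" where
  \<comment> \<open>\<open>group.ord\<close> is \<open>0\<close> exactly on elements of infinite order.\<close>
  "finite_order M x \<longleftrightarrow> group.ord (gp M) (gp_embed M x) \<noteq> 0"

definition undermonoid :: "'a set \<Rightarrow> ('a, 'm) monoid_scheme \<Rightarrow> bool" where
  "undermonoid N M \<longleftrightarrow> submonoid N M \<and> generate (gp M) (gp_embed M ` N) = carrier (gp M)"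

subsection \<open>Atoms and factorizations\<close>

definition atoms :: "('a, 'm) monoid_scheme \<Rightarrow> 'a set" where
  "atoms M = {a \<in> carrier M - Units M.
     \<forall>b \<in> carrier M. \<forall>c \<in> carrier M. a = b \<otimes>\<^bsub>M\<^esub> c \<longrightarrow> b \<in> Units M \<or> c \<in> Units M}"

text \<open>The value in \<open>M\<close> of a finite formal sum (multiset) of elements of \<open>M\<close>.\<close>

definition msum :: "('a, 'm) monoid_scheme \<Rightarrow> 'a multiset \<Rightarrow> 'a" where
  "msum M z = finprod M (\<lambda>a. a [^]\<^bsub>M\<^esub> count z a) (set_mset z)"

definition atomic :: "('a, 'm) monoid_scheme \<Rightarrow> bool" where
  "atomic M \<longleftrightarrow> (\<forall>b \<in> carrier M. b \<in> Units M \<or> (\<exists>z. set_mset z \<subseteq> atoms M \<and> b = msum M z))"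

text \<open>The quotient \<open>M / \<U>(M)\<close> is \<^term>\<open>M Mod Units M\<close>, whose elements are the cosets
  \<^term>\<open>Units M #>\<^bsub>M\<^esub> b\<close>.\<close>

definition factorization_monoid :: "('a, 'm) monoid_scheme \<Rightarrow> 'a set multiset set" where
  "factorization_monoid M = {z. set_mset z \<subseteq> atoms (M Mod Units M)}"

definition factorizations :: "('a, 'm) monoid_scheme \<Rightarrow> 'a \<Rightarrow> 'a set multiset set" where
  "factorizations M b =
     {z \<in> factorization_monoid M. msum (M Mod Units M) z = Units M #>\<^bsub>M\<^esub> b}"

definition lengths :: "('a, 'm) monoid_scheme \<Rightarrow> 'a \<Rightarrow> nat set" where
  "lengths M b = size ` factorizations M b"

definition half_factorial :: "('a, 'm) monoid_scheme \<Rightarrow> bool" where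
  "half_factorial M \<longleftrightarrow> atomic M \<and> (\<forall>b \<in> carrier M. card (lengths M b) = 1)"

subsection \<open>Well-definedness of the constructions\<close>

text \<open>\<^term>\<open>gp M\<close> is an abelian group consisting of the differences of elements of the embedded
  copy of \<open>M\<close>, \<^term>\<open>M Mod Units M\<close> is a commutative monoid, and \<^term>\<open>msum M\<close> is the homomorphic
  extension of the identity to multisets over \<open>M\<close>.\<close>

context comm_monoid_cancel begin

lemma equiv_diff_rel: "equiv (carrier G \<times> carrier G) (diff_rel G)"
proof (rule equivI)
  show "diff_rel G \<subseteq> (carrier G \<times> carrier G) \<times> (carrier G \<times> carrier G)"
    by (auto simp: diff_rel_def)
  show "refl_on (carrier G \<times> carrier G) (diff_rel G)"
    by (auto simp: refl_on_def diff_rel_def)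
  show "sym (diff_rel G)"
    by (auto simp: sym_def diff_rel_def)
  show "trans (diff_rel G)"
  proof (rule transI, clarsimp simp: diff_rel_def)
    fix a b c d e f
    assume c: "a \<in> carrier G" "b \<in> carrier G" "c \<in> carrier G" "d \<in> carrier G"
      "e \<in> carrier G" "f \<in> carrier G"
      and 1: "a \<otimes> d = c \<otimes> b" and 2: "c \<otimes> f = e \<otimes> d"
    have "(a \<otimes> f) \<otimes> d = (a \<otimes> d) \<otimes> f" using c by (simp add: m_ac)
    also have "\<dots> = (c \<otimes> f) \<otimes> b" unfolding 1 using c by (simp add: m_ac)
    also have "\<dots> = (e \<otimes> b) \<otimes> d" unfolding 2 using c by (simp add: m_ac)
    finally show "a \<otimes> f = e \<otimes> b" using c by (meson m_closed r_cancel)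
  qed
qed

lemma gp_mult_class:
  assumes "a \<in> carrier G" "b \<in> carrier G" "c \<in> carrier G" "d \<in> carrier G"
  shows "(diff_rel G `` {(a, b)}) \<otimes>\<^bsub>gp G\<^esub> (diff_rel G `` {(c, d)}) = diff_rel G `` {(a \<otimes> c, b \<otimes> d)}"
proof -
  let ?f = "\<lambda>p q. diff_rel G `` {(fst p \<otimes> fst q, snd p \<otimes> snd q)}"
  have "congruent2 (diff_rel G) (diff_rel G) ?f"
  proof (rule congruent2I')
    fix p p' q q'
    assume "(p, p') \<in> diff_rel G" "(q, q') \<in> diff_rel G"
    then obtain a b a' b' c d c' d' where p: "p = (a, b)" "p' = (a', b')" "q = (c, d)" "q' = (c', d')"
      and h: "a \<in> carrier G" "b \<in> carrier G" "a' \<in> carrier G" "b' \<in> carrier G"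
      "c \<in> carrier G" "d \<in> carrier G" "c' \<in> carrier G" "d' \<in> carrier G"
      and e: "a \<otimes> b' = a' \<otimes> b" "c \<otimes> d' = c' \<otimes> d"
      unfolding diff_rel_def by blast
    have "(a \<otimes> c) \<otimes> (b' \<otimes> d') = (a \<otimes> b') \<otimes> (c \<otimes> d')" using h by (simp add: m_ac)
    also have "\<dots> = (a' \<otimes> c') \<otimes> (b \<otimes> d)" unfolding e using h by (simp add: m_ac)
    finally have "((a \<otimes> c, b \<otimes> d), (a' \<otimes> c', b' \<otimes> d')) \<in> diff_rel G"
      using h by (simp add: diff_rel_def)
    then show "?f p q = ?f p' q'"
      unfolding p by (simp add: equiv_class_eq[OF equiv_diff_rel])
  qed
  from UN_equiv_class2[OF equiv_diff_rel equiv_diff_rel this, of "(a,b)" "(c,d)"] assms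
  show ?thesis by (simp add: gp_def case_prod_beta')
qed

lemma carrier_gpE:
  assumes "X \<in> carrier (gp G)"
  obtains a b where "a \<in> carrier G" "b \<in> carrier G" "X = diff_rel G `` {(a, b)}"
  using assms by (auto simp: gp_def elim!: quotientE)

lemma gp_class_closed:
  "\<lbrakk>a \<in> carrier G; b \<in> carrier G\<rbrakk> \<Longrightarrow> diff_rel G `` {(a, b)} \<in> carrier (gp G)"
  by (simp add: gp_def quotientI)

lemma comm_group_gp: "comm_group (gp G)"
proof (rule comm_groupI)
  have one: "\<one>\<^bsub>gp G\<^esub> = diff_rel G `` {(\<one>, \<one>)}" by (simp add: gp_def)
  show "\<one>\<^bsub>gp G\<^esub> \<in> carrier (gp G)" by (simp add: one gp_class_closed)
  fix x assume "x \<in> carrier (gp G)"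
  then obtain a b where x: "a \<in> carrier G" "b \<in> carrier G" "x = diff_rel G `` {(a, b)}"
    by (rule carrier_gpE)
  show "\<one>\<^bsub>gp G\<^esub> \<otimes>\<^bsub>gp G\<^esub> x = x" using x by (simp add: one gp_mult_class)
  have "((b \<otimes> a, a \<otimes> b), (\<one>, \<one>)) \<in> diff_rel G"
    using x by (simp add: diff_rel_def m_comm)
  then have "(diff_rel G `` {(b, a)}) \<otimes>\<^bsub>gp G\<^esub> x = \<one>\<^bsub>gp G\<^esub>"
    using x by (simp add: one gp_mult_class equiv_class_eq[OF equiv_diff_rel])
  then show "\<exists>y\<in>carrier (gp G). y \<otimes>\<^bsub>gp G\<^esub> x = \<one>\<^bsub>gp G\<^esub>" using x gp_class_closed by blast
  fix y assume "y \<in> carrier (gp G)"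
  then obtain c d where y: "c \<in> carrier G" "d \<in> carrier G" "y = diff_rel G `` {(c, d)}"
    by (rule carrier_gpE)
  show "x \<otimes>\<^bsub>gp G\<^esub> y \<in> carrier (gp G)" using x y by (simp add: gp_mult_class gp_class_closed)
  show "x \<otimes>\<^bsub>gp G\<^esub> y = y \<otimes>\<^bsub>gp G\<^esub> x" using x y by (simp add: gp_mult_class m_comm)
  fix z assume "z \<in> carrier (gp G)"
  then obtain e f where z: "e \<in> carrier G" "f \<in> carrier G" "z = diff_rel G `` {(e, f)}"
    by (rule carrier_gpE)
  show "x \<otimes>\<^bsub>gp G\<^esub> y \<otimes>\<^bsub>gp G\<^esub> z = x \<otimes>\<^bsub>gp G\<^esub> (y \<otimes>\<^bsub>gp G\<^esub> z)"
    using x y z by (simp add: gp_mult_class m_assoc)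
qed

lemma gp_embed_hom: "gp_embed G \<in> hom G (gp G)"
  by (auto simp: hom_def gp_embed_def gp_mult_class gp_class_closed)

lemma gp_embed_one: "gp_embed G \<one> = \<one>\<^bsub>gp G\<^esub>"
  by (simp add: gp_embed_def gp_def)

lemma inj_on_gp_embed: "inj_on (gp_embed G) (carrier G)"
proof (rule inj_onI)
  fix x y assume "x \<in> carrier G" "y \<in> carrier G" "gp_embed G x = gp_embed G y"
  then have "((x, \<one>), (y, \<one>)) \<in> diff_rel G"
    unfolding gp_embed_def by (intro eq_equiv_class[OF _ equiv_diff_rel]) auto
  then show "x = y" using \<open>x \<in> carrier G\<close> \<open>y \<in> carrier G\<close> by (simp add: diff_rel_def)
qed

lemma carrier_gp_eq_differences:
  "carrier (gp G) = {gp_embed G x \<otimes>\<^bsub>gp G\<^esub> inv\<^bsub>gp G\<^esub> gp_embed G y | x y. x \<in> carrier G \<and> y \<in> carrier G}"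
proof -
  interpret gp: comm_group "gp G" by (rule comm_group_gp)
  have e: "gp_embed G x \<otimes>\<^bsub>gp G\<^esub> inv\<^bsub>gp G\<^esub> gp_embed G y = diff_rel G `` {(x, y)}"
    if "x \<in> carrier G" "y \<in> carrier G" for x y
  proof -
    have "diff_rel G `` {(x, y)} \<otimes>\<^bsub>gp G\<^esub> gp_embed G y = diff_rel G `` {(x \<otimes> y, y)}"
      using that by (simp add: gp_embed_def gp_mult_class)
    also have "\<dots> = gp_embed G x" unfolding gp_embed_def using that
      by (intro equiv_class_eq[OF equiv_diff_rel]) (simp add: diff_rel_def)
    finally have "diff_rel G `` {(x, y)} \<otimes>\<^bsub>gp G\<^esub> gp_embed G y = gp_embed G x" .
    moreover have "gp_embed G y \<in> carrier (gp G)" "gp_embed G x \<in> carrier (gp G)"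
      using that gp_embed_hom by (auto simp: hom_def)
    ultimately show ?thesis using that gp_class_closed by (metis gp.inv_solve_right)
  qed
  have "X \<in> carrier (gp G) \<longleftrightarrow> (\<exists>x y. X = diff_rel G `` {(x, y)} \<and> x \<in> carrier G \<and> y \<in> carrier G)" for X
    by (metis carrier_gpE gp_class_closed)
  then have "carrier (gp G) = {diff_rel G `` {(x, y)} | x y. x \<in> carrier G \<and> y \<in> carrier G}"
    by blast
  also have "\<dots> = {gp_embed G x \<otimes>\<^bsub>gp G\<^esub> inv\<^bsub>gp G\<^esub> gp_embed G y | x y. x \<in> carrier G \<and> y \<in> carrier G}"
    by (intro Collect_cong) (metis e)
  finally show ?thesis .
qed

lemma finite_order_iff:
  assumes "x \<in> carrier G"
  shows "finite_order G x \<longleftrightarrow> (\<exists>n::nat. n > 0 \<and> x [^] n = \<one>)"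
proof -
  interpret gp: comm_group "gp G" by (rule comm_group_gp)
  have c: "gp_embed G x \<in> carrier (gp G)" using assms gp_embed_hom by (auto simp: hom_def)
  have p: "gp_embed G (x [^] n) = gp_embed G x [^]\<^bsub>gp G\<^esub> n" for n :: nat
    using assms gp_embed_hom by (induction n) (auto simp: gp_embed_one hom_mult)
  have "x [^] n = \<one> \<longleftrightarrow> gp.ord (gp_embed G x) dvd n" for n :: nat
    using gp.pow_eq_id[OF c, of n] inj_on_gp_embed assms
    by (metis gp_embed_one inj_on_eq_iff nat_pow_closed one_closed p)
  then show ?thesis unfolding finite_order_def by (metis dvd_0_left_iff dvd_refl gr0I not_gr0)
qed

lemma Units_coset_mult:
  assumes "a \<in> carrier G" "b \<in> carrier G"
  shows "(Units G #> a) <#> (Units G #> b) = Units G #> (a \<otimes> b)"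
proof (intro equalityI subsetI)
  fix x assume "x \<in> (Units G #> a) <#> (Units G #> b)"
  then obtain u v where uv: "u \<in> Units G" "v \<in> Units G" "x = (u \<otimes> a) \<otimes> (v \<otimes> b)"
    by (auto simp: r_coset_def set_mult_def)
  then have "x = (u \<otimes> v) \<otimes> (a \<otimes> b)"
    using assms by (simp add: m_ac Units_closed)
  moreover have "u \<otimes> v \<in> Units G" using uv by simp
  ultimately show "x \<in> Units G #> (a \<otimes> b)"
    unfolding r_coset_def by blast
next
  fix x assume "x \<in> Units G #> (a \<otimes> b)"
  then obtain u where u: "u \<in> Units G" "x = u \<otimes> (a \<otimes> b)"
    by (auto simp: r_coset_def)
  then have "x = (u \<otimes> a) \<otimes> (\<one> \<otimes> b)"
    using assms by (simp add: m_assoc Units_closed)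
  moreover have "u \<otimes> a \<in> Units G #> a" "\<one> \<otimes> b \<in> Units G #> b"
    unfolding r_coset_def using u Units_one_closed by blast+
  ultimately show "x \<in> (Units G #> a) <#> (Units G #> b)"
    unfolding set_mult_def by blast
qed

lemma comm_monoid_Mod_Units: "comm_monoid (G Mod Units G)"
proof -
  have one: "Units G = Units G #> \<one>"
    by (auto simp: r_coset_def Units_closed)
  show ?thesis
  proof (rule comm_monoidI)
    show "\<one>\<^bsub>G Mod Units G\<^esub> \<in> carrier (G Mod Units G)"
      unfolding FactGroup_def RCOSETS_def using one by auto
    fix x assume "x \<in> carrier (G Mod Units G)"
    then obtain a where a: "a \<in> carrier G" "x = Units G #> a" by (auto simp: FactGroup_def RCOSETS_def)
    show "\<one>\<^bsub>G Mod Units G\<^esub> \<otimes>\<^bsub>G Mod Units G\<^esub> x = x"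
      using a one Units_coset_mult[of \<one> a] by (simp add: FactGroup_def)
    fix y assume "y \<in> carrier (G Mod Units G)"
    then obtain b where b: "b \<in> carrier G" "y = Units G #> b" by (auto simp: FactGroup_def RCOSETS_def)
    show "x \<otimes>\<^bsub>G Mod Units G\<^esub> y \<in> carrier (G Mod Units G)"
      using a b by (auto simp: FactGroup_def RCOSETS_def Units_coset_mult)
    show "x \<otimes>\<^bsub>G Mod Units G\<^esub> y = y \<otimes>\<^bsub>G Mod Units G\<^esub> x"
      using a b by (simp add: FactGroup_def Units_coset_mult m_comm)
    fix z assume "z \<in> carrier (G Mod Units G)"
    then obtain c where c: "c \<in> carrier G" "z = Units G #> c" by (auto simp: FactGroup_def RCOSETS_def)
    show "x \<otimes>\<^bsub>G Mod Units G\<^esub> y \<otimes>\<^bsub>G Mod Units G\<^esub> z = x \<otimes>\<^bsub>G Mod Units G\<^esub> (y \<otimes>\<^bsub>G Mod Units G\<^esub> z)"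
      using a b c by (simp add: FactGroup_def Units_coset_mult m_assoc)
  qed
qed

end

context comm_monoid begin

lemma msum_empty: "msum G {#} = \<one>"
  by (simp add: msum_def)

lemma msum_add_mset:
  assumes "a \<in> carrier G" "set_mset z \<subseteq> carrier G"
  shows "msum G (add_mset a z) = a \<otimes> msum G z"
proof -
  let ?S = "set_mset z - {a}"
  let ?P = "finprod G (\<lambda>b. b [^] count z b) ?S"
  have S: "finite ?S" "a \<notin> ?S" and f: "(\<lambda>b. b [^] count z b) \<in> ?S \<rightarrow> carrier G" using assms by auto
  have P: "?P \<in> carrier G" using f by (rule finprod_closed)
  have 1: "msum G z = a [^] count z a \<otimes> ?P"
  proof (cases "a \<in># z")
    case True
    then have eq: "set_mset z = insert a ?S" by auto
    have "msum G z = finprod G (\<lambda>b. b [^] count z b) (insert a ?S)"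
      unfolding msum_def by (subst eq) (rule refl)
    then show ?thesis using finprod_insert[OF S f] assms by simp
  next
    case False
    then have "count z a = 0" "?S = set_mset z" by (auto simp: not_in_iff)
    then show ?thesis using P by (simp add: msum_def)
  qed
  have "msum G (add_mset a z) = finprod G (\<lambda>b. b [^] count (add_mset a z) b) (insert a ?S)"
    by (simp add: msum_def)
  also have "\<dots> = a [^] Suc (count z a) \<otimes> finprod G (\<lambda>b. b [^] count (add_mset a z) b) ?S"
    using assms S by (subst finprod_insert) auto
  also have "finprod G (\<lambda>b. b [^] count (add_mset a z) b) ?S = ?P"
    using f by (intro finprod_cong') auto
  finally show ?thesis using 1 P assms by (simp add: m_ac)
qed

end

end

theory Submission
  imports Defs
begin

text \<open>
  In a torsion group every submonoid is a group, because the inverse of \<open>x\<close> is a power of \<open>x\<close>.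
  In a group everything is invertible, so that the empty factorization is the only one, and the
  group is half-factorial. This is \<open>submonoid_half_factorial_if_torsion\<close>.

  For the converse suppose that all undermonoids of \<open>M\<close> are half-factorial. The decisive step is
  \<open>all_Units_if_undermonoids_half_factorial\<close>: every undermonoid \<open>P\<close> of \<open>M\<close> is a group. On a
  half-factorial monoid the common length of all factorizations of an element is additive, vanishes
  only on units, and is \<open>1\<close> on atoms (\<open>half_factorial_length\<close>). If \<open>a\<close> were a noninvertible element
  of \<open>P\<close>, of length \<open>k > 0\<close>, then one could cut off the bottom of \<open>P\<close> and keep, besides the
  identity, only the elements of length at least \<open>2k\<close>. What remains is still an undermonoid of \<open>M\<close>,
  but now \<open>a\<^sup>2\<close> and \<open>a\<^sup>3\<close> are atoms, just as \<open>2\<close> and \<open>3\<close> are atoms of the numerical monoid that they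
  generate, and \<open>a\<^sup>6\<close> is a product of three copies of the one and of two copies of the other.

  Applied to \<open>P = M\<close>, this shows that \<open>M\<close> is a group. If \<open>M\<close> had an element \<open>x\<close> of infinite order,
  then Zorn's lemma would give a submonoid \<open>P\<close> that contains \<open>x\<close>, does not contain its inverse, and
  is total: it contains each element of \<open>M\<close> or its inverse (\<open>total_submonoid_exists\<close>; \<open>P\<close> is the
  nonnegative cone of a total preorder of \<open>M\<close> in which \<open>x\<close> is strictly positive). By totality \<open>P\<close> is
  an undermonoid, and it is not a group because \<open>x\<close> has no inverse in it: a contradiction.
\<close>

section \<open>Submonoids and undermonoids\<close>

lemma (in comm_monoid_cancel) submonoid_comm_monoid_cancel:
  assumes "submonoid N G"
  shows "comm_monoid_cancel (G\<lparr>carrier := N\<rparr>)"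
proof -
  interpret N: submonoid N G by (rule assms)
  show ?thesis
  proof (rule comm_monoid_cancelI)
    show "comm_monoid (G\<lparr>carrier := N\<rparr>)"
      by (rule comm_monoidI) (auto intro: m_assoc m_comm)
  qed (use r_cancel in auto)
qed

text \<open>This criterion never leaves \<open>G\<close>: in \<open>gp G\<close> the equation \<open>m \<otimes> q = p\<close> makes \<open>m\<close> the difference
  of \<open>p\<close> and \<open>q\<close>, so the subgroup generated by \<open>N\<close> contains \<open>G\<close>, and \<open>gp G\<close> consists of the
  differences of elements of \<open>G\<close>.\<close>

lemma (in comm_monoid_cancel) undermonoidI:
  assumes N: "submonoid N G"
    and diff: "\<And>m. m \<in> carrier G \<Longrightarrow> \<exists>p\<in>N. \<exists>q\<in>N. m \<otimes> q = p"
  shows "undermonoid N G"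
proof -
  interpret N: submonoid N G by (rule N)
  interpret gp: comm_group "gp G" by (rule comm_group_gp)
  let ?H = "generate (gp G) (gp_embed G ` N)"
  have c: "gp_embed G x \<in> carrier (gp G)" if "x \<in> carrier G" for x
    using that gp_embed_hom by (auto simp: hom_def)
  have H: "subgroup ?H (gp G)"
    using c by (intro gp.generate_is_subgroup) auto
  have emb: "gp_embed G m \<in> ?H" if m: "m \<in> carrier G" for m
  proof -
    obtain p q where pq: "p \<in> N" "q \<in> N" "m \<otimes> q = p" using diff[OF m] by blast
    have "gp_embed G p = gp_embed G m \<otimes>\<^bsub>gp G\<^esub> gp_embed G q"
      using hom_mult[OF gp_embed_hom m, of q] pq by simp
    then have "gp_embed G m = gp_embed G p \<otimes>\<^bsub>gp G\<^esub> inv\<^bsub>gp G\<^esub> gp_embed G q"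
      using c m pq gp.inv_solve_right by (metis N.mem_carrier)
    moreover have "gp_embed G p \<in> ?H" "gp_embed G q \<in> ?H"
      using pq by (auto intro: generate.incl)
    ultimately show ?thesis
      using subgroup.m_closed[OF H] subgroup.m_inv_closed[OF H] by simp
  qed
  have "carrier (gp G) \<subseteq> ?H"
    unfolding carrier_gp_eq_differences
    using emb subgroup.m_closed[OF H] subgroup.m_inv_closed[OF H] by auto
  then have "?H = carrier (gp G)" using subgroup.subset[OF H] by blast
  then show ?thesis using N unfolding undermonoid_def by simp
qed

section \<open>The length function of a half-factorial monoid\<close>

lemma (in comm_monoid) msum_closed:
  "set_mset z \<subseteq> carrier G \<Longrightarrow> msum G z \<in> carrier G"
  by (induction z) (auto simp: msum_empty msum_add_mset)

lemma (in comm_monoid) msum_union: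
  assumes "set_mset z \<subseteq> carrier G" "set_mset w \<subseteq> carrier G"
  shows "msum G (z + w) = msum G z \<otimes> msum G w"
  using assms(1)
proof (induction z)
  case empty
  show ?case using assms msum_closed by (simp add: msum_empty)
next
  case (add a z)
  then show ?case using assms msum_closed
    by (simp add: msum_add_mset m_assoc)
qed

context comm_monoid_cancel begin

lemma Units_rcoset_eq_Units_iff:
  assumes "b \<in> carrier G"
  shows "Units G #> b = Units G \<longleftrightarrow> b \<in> Units G"
proof
  assume "Units G #> b = Units G"
  moreover have "b \<in> Units G #> b"
    using assms unfolding r_coset_def by (auto intro: bexI[of _ \<one>])
  ultimately show "b \<in> Units G" by simp
next
  assume b: "b \<in> Units G"
  show "Units G #> b = Units G"
  proof (intro equalityI subsetI)
    fix x assume x: "x \<in> Units G"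
    then have "x = (x \<otimes> inv b) \<otimes> b" "x \<otimes> inv b \<in> Units G"
      using b by (auto simp: m_assoc Units_closed)
    then show "x \<in> Units G #> b" unfolding r_coset_def by blast
  qed (use b in \<open>auto simp: r_coset_def\<close>)
qed

lemma Units_Mod_Units: "Units (G Mod Units G) = {Units G}"
proof
  interpret Q: comm_monoid "G Mod Units G" by (rule comm_monoid_Mod_Units)
  show "{Units G} \<subseteq> Units (G Mod Units G)"
    using Q.Units_one_closed by (simp add: one_FactGroup)
  show "Units (G Mod Units G) \<subseteq> {Units G}"
  proof
    fix X assume "X \<in> Units (G Mod Units G)"
    then obtain a b where ab: "a \<in> carrier G" "b \<in> carrier G" "X = Units G #> a"
      "(Units G #> a) \<otimes>\<^bsub>G Mod Units G\<^esub> (Units G #> b) = Units G"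
      unfolding Units_def[of "G Mod Units G"] carrier_FactGroup one_FactGroup by blast
    then have "a \<otimes> b \<in> Units G"
      using Units_rcoset_eq_Units_iff[of "a \<otimes> b"] by (simp add: Units_coset_mult)
    then have "a \<in> Units G" using ab(1,2) by (rule unit_factor)
    then show "X \<in> {Units G}"
      using ab(1,3) Units_rcoset_eq_Units_iff by simp
  qed
qed

text \<open>Equality of cosets only gives \<open>a = u \<otimes> b \<otimes> c\<close> with a unit \<open>u\<close>; absorbing \<open>u\<close> into \<open>b\<close> turns
  this into a factorization of \<open>a\<close> in \<open>G\<close>.\<close>

lemma atom_rcoset_Units:
  assumes "a \<in> atoms G"
  shows "Units G #> a \<in> atoms (G Mod Units G)"
proof -
  have a: "a \<in> carrier G" "a \<notin> Units G" using assms by (auto simp: atoms_def)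
  have "Units G #> b = Units G \<or> Units G #> c = Units G"
    if bc: "b \<in> carrier G" "c \<in> carrier G" "Units G #> a = Units G #> (b \<otimes> c)" for b c
  proof -
    have "a \<in> Units G #> a"
      using a unfolding r_coset_def by (auto intro: bexI[of _ \<one>])
    then obtain u where u: "u \<in> Units G" "a = u \<otimes> (b \<otimes> c)"
      using bc by (auto simp: r_coset_def)
    then have "a = (u \<otimes> b) \<otimes> c" "u \<otimes> b \<in> carrier G"
      using bc by (auto simp: m_assoc Units_closed)
    then have "u \<otimes> b \<in> Units G \<or> c \<in> Units G"
      using assms bc unfolding atoms_def by blast
    moreover have "b \<in> Units G" if "u \<otimes> b \<in> Units G"
      using that u bc unit_factor[of b u] by (simp add: m_comm Units_closed)
    ultimately show ?thesis using bc Units_rcoset_eq_Units_iff by blast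
  qed
  then show ?thesis
    using a Units_rcoset_eq_Units_iff[of a]
    unfolding atoms_def[of "G Mod Units G"] carrier_FactGroup Units_Mod_Units
    by (auto simp: Units_coset_mult)
qed

text \<open>The length is additive because concatenating factorizations of \<open>b\<close> and \<open>c\<close> gives a
  factorization of \<open>b \<otimes> c\<close>, and all factorizations of the latter have the same length.\<close>

lemma half_factorial_length:
  assumes "half_factorial G"
  shows "\<exists>len :: 'a \<Rightarrow> nat.
    (\<forall>b\<in>carrier G. \<forall>c\<in>carrier G. len (b \<otimes> c) = len b + len c) \<and>
    (\<forall>b\<in>carrier G - Units G. len b > 0) \<and>
    (\<forall>a\<in>atoms G. len a = 1)"
proof -
  interpret Q: comm_monoid "G Mod Units G" by (rule comm_monoid_Mod_Units)
  define len where "len b = the_elem (lengths G b)" for b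
  have single: "lengths G b = {len b}" if "b \<in> carrier G" for b
    using assms that card_1_singletonE[of "lengths G b"]
    unfolding half_factorial_def len_def by (metis the_elem_eq)
  have lenI: "len b = size z" if "z \<in> factorizations G b" "b \<in> carrier G" for z b
    using single[OF that(2)] that(1) unfolding lengths_def by (metis imageI singletonD)
  have lenE: "\<exists>z \<in> factorizations G b. len b = size z" if "b \<in> carrier G" for b
    using single[OF that] unfolding lengths_def by blast
  have sub: "atoms (G Mod Units G) \<subseteq> carrier (G Mod Units G)" by (auto simp: atoms_def)
  have add: "len (b \<otimes> c) = len b + len c" if bc: "b \<in> carrier G" "c \<in> carrier G" for b c
  proof -
    obtain z w where z: "z \<in> factorizations G b" "len b = size z"
      and w: "w \<in> factorizations G c" "len c = size w"
      using lenE bc by meson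
    have "set_mset z \<subseteq> carrier (G Mod Units G)" "set_mset w \<subseteq> carrier (G Mod Units G)"
      using z w sub by (auto simp: factorizations_def factorization_monoid_def)
    then have "msum (G Mod Units G) (z + w) = Units G #> (b \<otimes> c)"
      using z w bc by (simp add: Q.msum_union factorizations_def Units_coset_mult)
    then have "z + w \<in> factorizations G (b \<otimes> c)"
      using z w by (auto simp: factorizations_def factorization_monoid_def)
    then show ?thesis using lenI[of "z + w" "b \<otimes> c"] z w bc by simp
  qed
  have pos: "len b > 0" if b: "b \<in> carrier G" "b \<notin> Units G" for b
  proof (rule ccontr)
    assume "\<not> len b > 0"
    then have "{#} \<in> factorizations G b" using lenE[OF b(1)] by auto
    then have "Units G #> b = Units G"
      by (simp add: factorizations_def Q.msum_empty one_FactGroup)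
    then show False using b Units_rcoset_eq_Units_iff by blast
  qed
  have atom: "len a = 1" if a: "a \<in> atoms G" for a
  proof -
    have at: "Units G #> a \<in> atoms (G Mod Units G)" by (rule atom_rcoset_Units[OF a])
    then have "Units G #> a \<in> carrier (G Mod Units G)" using sub by blast
    then have "{#Units G #> a#} \<in> factorizations G a"
      using at by (simp add: factorizations_def factorization_monoid_def
          Q.msum_add_mset Q.msum_empty del: one_FactGroup mult_FactGroup)
    then show ?thesis using lenI[of _ a] a by (auto simp: atoms_def)
  qed
  show ?thesis using add pos atom by blast
qed

text \<open>The quotient by the units is trivial here and has no atoms, which leaves the empty multiset as
  the only formal sum of atoms.\<close>

lemma half_factorial_if_all_Units:
  assumes "carrier G \<subseteq> Units G"
  shows "half_factorial G"
proof -
  interpret Q: comm_monoid "G Mod Units G" by (rule comm_monoid_Mod_Units)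
  have "carrier (G Mod Units G) \<subseteq> Units (G Mod Units G)"
    using assms Units_rcoset_eq_Units_iff by (auto simp: carrier_FactGroup Units_Mod_Units)
  then have "atoms (G Mod Units G) = {}" by (auto simp: atoms_def)
  then have "factorizations G b = {{#}}" if "b \<in> carrier G" for b
    using that assms Units_rcoset_eq_Units_iff[of b]
    by (auto simp: factorizations_def factorization_monoid_def Q.msum_empty one_FactGroup)
  then show ?thesis using assms by (auto simp: half_factorial_def atomic_def lengths_def)
qed

section \<open>Noninvertible elements of undermonoids\<close>

text \<open>By \<open>undermonoidI\<close> the hypothesis \<open>diff\<close> makes \<open>P\<close> an undermonoid of \<open>G\<close>. The proof looks for the bad
  undermonoid inside \<open>P\<close> and uses half-factoriality twice: for \<open>P\<close>, to obtain the length by which \<open>P\<close>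
  is truncated, and for the truncation, to compare the two factorizations of the sixth power
  of \<open>a\<close>.\<close>

lemma all_Units_if_undermonoids_half_factorial:
  assumes hf: "\<And>N. undermonoid N G \<Longrightarrow> half_factorial (G\<lparr>carrier := N\<rparr>)"
    and P: "submonoid P G"
    and diff: "\<And>m. m \<in> carrier G \<Longrightarrow> \<exists>p\<in>P. \<exists>q\<in>P. m \<otimes> q = p"
    and a: "a \<in> P"
  shows "\<exists>b\<in>P. a \<otimes> b = \<one>"
proof (rule ccontr)
  assume no_inv: "\<not> (\<exists>b\<in>P. a \<otimes> b = \<one>)"
  interpret P: submonoid P G by (rule P)
  interpret PM: comm_monoid_cancel "G\<lparr>carrier := P\<rparr>"
    by (rule submonoid_comm_monoid_cancel[OF P])
  obtain len :: "'a \<Rightarrow> nat"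
    where "\<forall>b\<in>P. \<forall>c\<in>P. len (b \<otimes> c) = len b + len c"
      and pos: "\<forall>b\<in>P - Units (G\<lparr>carrier := P\<rparr>). len b > 0"
    using PM.half_factorial_length[OF hf[OF undermonoidI[OF P diff]]] by auto
  then have add: "len (b \<otimes> c) = len b + len c" if "b \<in> P" "c \<in> P" for b c
    using that by blast
  define k where "k = len a"
  have k: "k > 0"
    using bspec[OF pos, of a] no_inv a by (auto simp: k_def Units_def)
  have len1: "len \<one> = 0" using add[of \<one> \<one>] by simp
  \<comment> \<open>A product of two elements of \<open>N\<close> other than \<open>\<one>\<close> has length at least \<open>4 * k\<close>. The elements \<open>a\<^sup>2\<close>
    and \<open>a\<^sup>3\<close> have lengths \<open>2 * k\<close> and \<open>3 * k\<close>, so they belong to \<open>N\<close> without being such products.\<close>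
  define N where "N = insert \<one> {m \<in> P. len m \<ge> 2 * k}"
  have NP: "N \<subseteq> P" by (auto simp: N_def)
  have N: "submonoid N G"
    by unfold_locales (use add in \<open>auto simp: N_def\<close>)
  have aa: "a \<otimes> a \<in> N" "a \<otimes> a \<otimes> a \<in> N"
    using a add k by (auto simp: N_def k_def)
  have diffN: "\<exists>p\<in>N. \<exists>q\<in>N. m \<otimes> q = p" if m: "m \<in> carrier G" for m
  proof -
    obtain p q where pq: "p \<in> P" "q \<in> P" "m \<otimes> q = p" using diff[OF m] by blast
    \<comment> \<open>Multiplying numerator and denominator by \<open>a\<^sup>2\<close> gives both a length of at least \<open>2 * k\<close>.\<close>
    have "p \<otimes> (a \<otimes> a) \<in> N" "q \<otimes> (a \<otimes> a) \<in> N"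
      using a pq add by (auto simp: N_def k_def)
    moreover have "m \<otimes> (q \<otimes> (a \<otimes> a)) = p \<otimes> (a \<otimes> a)"
      using m a pq by (auto simp: m_assoc[symmetric])
    ultimately show ?thesis by blast
  qed
  interpret NM: comm_monoid_cancel "G\<lparr>carrier := N\<rparr>"
    by (rule submonoid_comm_monoid_cancel[OF N])
  have Units_N: "x = \<one>" if x: "x \<in> Units (G\<lparr>carrier := N\<rparr>)" for x
  proof -
    obtain y where y: "x \<in> N" "y \<in> N" "x \<otimes> y = \<one>" using x by (auto simp: Units_def)
    then have "len x + len y = 0" using add[of x y] NP len1 by auto
    then show ?thesis using y(1) k by (auto simp: N_def)
  qed
  have atomI: "m \<in> atoms (G\<lparr>carrier := N\<rparr>)"
    if m: "m \<in> N" "m \<noteq> \<one>" "len m < 4 * k" for m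
  proof -
    have "b = \<one> \<or> c = \<one>" if "b \<in> N" "c \<in> N" "m = b \<otimes> c" for b c
      using that m(3) add[of b c] NP by (auto simp: N_def)
    then have "b \<in> Units (G\<lparr>carrier := N\<rparr>) \<or> c \<in> Units (G\<lparr>carrier := N\<rparr>)"
      if "b \<in> N" "c \<in> N" "m = b \<otimes> c" for b c
      using that NM.Units_one_closed by fastforce
    then show ?thesis using m Units_N by (auto simp: atoms_def)
  qed
  have len_aa: "len (a \<otimes> a) = 2 * k" "len (a \<otimes> a \<otimes> a) = 3 * k"
    using a add by (auto simp: k_def)
  have at: "a \<otimes> a \<in> atoms (G\<lparr>carrier := N\<rparr>)" "a \<otimes> a \<otimes> a \<in> atoms (G\<lparr>carrier := N\<rparr>)"
    using atomI aa len_aa len1 k by fastforce+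
  obtain len' :: "'a \<Rightarrow> nat"
    where add': "\<forall>b\<in>N. \<forall>c\<in>N. len' (b \<otimes> c) = len' b + len' c"
      and atom': "\<forall>m\<in>atoms (G\<lparr>carrier := N\<rparr>). len' m = 1"
    using NM.half_factorial_length[OF hf[OF undermonoidI[OF N diffN]]] by auto
  have "a \<otimes> a \<otimes> (a \<otimes> a) \<otimes> (a \<otimes> a) = a \<otimes> a \<otimes> a \<otimes> (a \<otimes> a \<otimes> a)"
    using a by (simp add: m_assoc)
  moreover have "a \<otimes> a \<otimes> (a \<otimes> a) \<in> N" using submonoid.m_closed[OF N] aa by blast
  ultimately have "len' (a \<otimes> a) + len' (a \<otimes> a) + len' (a \<otimes> a)
      = len' (a \<otimes> a \<otimes> a) + len' (a \<otimes> a \<otimes> a)"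
    using add' aa by metis
  then show False using at atom' by simp
qed

end

section \<open>Total submonoids of abelian groups\<close>

lemma (in comm_monoid) submonoid_adjoin:
  fixes P g
  defines "Q \<equiv> {p \<otimes> g [^] n | p n. p \<in> P \<and> n \<in> (UNIV :: nat set)}"
  assumes P: "submonoid P G" and g: "g \<in> carrier G"
  shows "submonoid Q G" "g \<in> Q" "P \<subseteq> Q"
proof -
  interpret P: submonoid P G by (rule P)
  have QI: "p \<otimes> g [^] n \<in> Q" if "p \<in> P" for p and n :: nat
    using that unfolding Q_def by blast
  show "g \<in> Q" using QI[of \<one> 1] g by simp
  show PQ: "P \<subseteq> Q"
  proof
    fix p assume "p \<in> P"
    then show "p \<in> Q" using QI[of p 0] by simp
  qed
  show "submonoid Q G"
  proof
    show "Q \<subseteq> carrier G" using g by (auto simp: Q_def)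
    show "\<one> \<in> Q" using PQ by auto
    fix x y assume "x \<in> Q" "y \<in> Q"
    then obtain p q and n m :: nat where
      xy: "p \<in> P" "q \<in> P" "x = p \<otimes> g [^] n" "y = q \<otimes> g [^] m"
      unfolding Q_def by blast
    then have "x \<otimes> y = (p \<otimes> q) \<otimes> g [^] (n + m)"
      using g by (simp add: nat_pow_mult[symmetric] m_ac)
    then show "x \<otimes> y \<in> Q" using QI[of "p \<otimes> q"] xy by simp
  qed
qed

lemma (in monoid) submonoid_nat_pow_closed:
  assumes "submonoid P G" "p \<in> P"
  shows "p [^] (n::nat) \<in> P"
  using assms by (induction n) (auto intro: submonoid.one_closed submonoid.m_closed)

text \<open>Among the submonoids that contain \<open>x\<close> but not \<open>inv x\<close>, the powers of \<open>x\<close> form one because \<open>x\<close>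
  has infinite order; a maximal one is total. Indeed, if neither \<open>g\<close> nor \<open>inv g\<close> belonged to \<open>P\<close>, then
  by maximality adjoining either of them to \<open>P\<close> would produce \<open>inv x\<close>. Raising the two resulting
  expressions of \<open>inv x\<close> to suitable powers and multiplying them cancels \<open>g\<close> and leaves a positive
  power of \<open>inv x\<close> in \<open>P\<close>. As \<open>x\<close> lies in \<open>P\<close>, so does \<open>inv x\<close> itself.\<close>

lemma (in comm_group) total_submonoid_exists:
  assumes x: "x \<in> carrier G" and inf: "\<And>n::nat. n > 0 \<Longrightarrow> x [^] n \<noteq> \<one>"
  obtains P where "submonoid P G" "x \<in> P" "inv x \<notin> P"
    "\<And>g. g \<in> carrier G \<Longrightarrow> g \<in> P \<or> inv g \<in> P"
proof -
  define \<A> where "\<A> = {P. submonoid P G \<and> x \<in> P \<and> inv x \<notin> P}"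
  have "\<exists>P\<in>\<A>. \<forall>Q\<in>\<A>. P \<subseteq> Q \<longrightarrow> Q = P"
  proof (rule subset_Zorn_nonempty)
    \<comment> \<open>The powers of \<open>x\<close>, written as the result of adjoining \<open>x\<close> to the trivial submonoid.\<close>
    let ?Q = "{p \<otimes> x [^] n | p n. p \<in> {\<one>} \<and> n \<in> (UNIV :: nat set)}"
    have "submonoid {\<one>} G" by unfold_locales auto
    then have "submonoid ?Q G" "x \<in> ?Q" using submonoid_adjoin x by blast+
    moreover have "inv x \<notin> ?Q"
    proof
      assume "inv x \<in> ?Q"
      then obtain n :: nat where "inv x = x [^] n" using x by auto
      then have "x [^] Suc n = \<one>" using x by (metis l_inv nat_pow_Suc)
      then show False using inf by blast
    qed
    ultimately show "\<A> \<noteq> {}" unfolding \<A>_def by blast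
  next
    fix C assume C: "C \<noteq> {}" "subset.chain \<A> C"
    have sub: "submonoid P G" if "P \<in> C" for P
      using that C by (auto simp: subset_chain_def \<A>_def)
    have "submonoid (\<Union>C) G"
    proof
      show "\<Union>C \<subseteq> carrier G" using sub submonoid.subset by blast
      show "\<one> \<in> \<Union>C" using C sub submonoid.one_closed by blast
      fix y z assume "y \<in> \<Union>C" "z \<in> \<Union>C"
      then obtain P where P: "P \<in> C" "y \<in> P" "z \<in> P"
        using C by (meson UnionE subset_chain_def subsetD)
      then have "y \<otimes> z \<in> P" by (intro submonoid.m_closed[OF sub])
      then show "y \<otimes> z \<in> \<Union>C" using P(1) by blast
    qed
    then show "\<Union>C \<in> \<A>" using C by (auto simp: subset_chain_def \<A>_def)
  qed
  then obtain P where P: "submonoid P G" "x \<in> P" "inv x \<notin> P"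
    and max: "\<And>Q. \<lbrakk>submonoid Q G; inv x \<notin> Q; P \<subseteq> Q\<rbrakk> \<Longrightarrow> Q = P"
    unfolding \<A>_def by blast
  interpret P: submonoid P G by (rule P)
  have reach: "\<exists>p\<in>P. \<exists>n::nat. n > 0 \<and> p \<otimes> g [^] n = inv x"
    if g: "g \<in> carrier G" "g \<notin> P" for g
  proof -
    let ?Q = "{p \<otimes> g [^] n | p n. p \<in> P \<and> n \<in> (UNIV :: nat set)}"
    have "submonoid ?Q G" "g \<in> ?Q" "P \<subseteq> ?Q"
      using submonoid_adjoin[OF P(1) g(1)] by simp_all
    then have "inv x \<in> ?Q" using max[of ?Q] g(2) by blast
    then obtain p and n :: nat where pn: "p \<in> P" "p \<otimes> g [^] n = inv x" by auto
    moreover have "n \<noteq> 0" using pn P by (intro notI) auto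
    ultimately show ?thesis by blast
  qed
  have "g \<in> P \<or> inv g \<in> P" if g: "g \<in> carrier G" for g
  proof (rule ccontr)
    assume "\<not> (g \<in> P \<or> inv g \<in> P)"
    then obtain p q and n m :: nat where
      pq: "p \<in> P" "q \<in> P" and nm: "n > 0" "m > 0" and
      eq: "p \<otimes> g [^] n = inv x" "q \<otimes> inv g [^] m = inv x"
      using reach[of g] reach[of "inv g"] g by auto
    let ?r = "p [^] m \<otimes> q [^] n"
    have car: "p \<in> carrier G" "q \<in> carrier G" using pq by auto
    have gg: "g [^] (n * m) \<otimes> inv g [^] (m * n) = \<one>"
      using g by (simp add: nat_pow_inv mult.commute)
    have "inv x [^] (m + n) = (p \<otimes> g [^] n) [^] m \<otimes> (q \<otimes> inv g [^] m) [^] n"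
      unfolding eq using x by (simp add: nat_pow_mult)
    also have "\<dots> = ?r \<otimes> (g [^] (n * m) \<otimes> inv g [^] (m * n))"
      using g car by (simp add: nat_pow_distrib nat_pow_pow m_ac)
    also have "\<dots> = ?r" using gg car by simp
    finally have r: "inv x [^] (m + n) = ?r" .
    obtain j where j: "m + n = Suc j" using nm by (cases "m + n") auto
    have "inv x [^] Suc j \<otimes> x [^] j = inv x"
      using x by (simp add: nat_pow_inv m_ac)
    moreover have "?r \<otimes> x [^] j \<in> P"
      using pq P submonoid_nat_pow_closed by auto
    ultimately show False using P r j by simp
  qed
  then show thesis using that P by blast
qed

section \<open>Torsion groups\<close>

lemma (in comm_monoid_cancel) submonoid_half_factorial_if_torsion:
  assumes tor: "\<And>x. x \<in> carrier G \<Longrightarrow> finite_order G x" and N: "submonoid N G"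
  shows "half_factorial (G\<lparr>carrier := N\<rparr>)"
proof -
  interpret N: submonoid N G by (rule N)
  interpret NM: comm_monoid_cancel "G\<lparr>carrier := N\<rparr>"
    by (rule submonoid_comm_monoid_cancel[OF N])
  have "x \<in> Units (G\<lparr>carrier := N\<rparr>)" if x: "x \<in> N" for x
  proof -
    have xc: "x \<in> carrier G" using x by simp
    obtain n :: nat where n: "n > 0" "x [^] n = \<one>"
      using tor[OF xc] finite_order_iff[OF xc] by blast
    obtain j where j: "n = Suc j" using n by (cases n) auto
    have "x [^] j \<in> N" using submonoid_nat_pow_closed N x by blast
    moreover have "x [^] j \<otimes> x = \<one>" "x \<otimes> x [^] j = \<one>"
      using n j xc by (auto simp: m_comm)
    ultimately show ?thesis using x by (auto simp: Units_def)
  qed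
  then show ?thesis by (intro NM.half_factorial_if_all_Units) auto
qed

lemma (in comm_monoid_cancel) torsion_group_if_undermonoids_half_factorial:
  assumes hf: "\<And>N. undermonoid N G \<Longrightarrow> half_factorial (G\<lparr>carrier := N\<rparr>)"
  shows "group G \<and> (\<forall>x\<in>carrier G. finite_order G x)"
proof
  have "submonoid (carrier G) G" by unfold_locales auto
  moreover have "\<exists>p\<in>carrier G. \<exists>q\<in>carrier G. m \<otimes> q = p" if "m \<in> carrier G" for m
    using that by blast
  ultimately have "\<exists>b\<in>carrier G. a \<otimes> b = \<one>" if "a \<in> carrier G" for a
    using all_Units_if_undermonoids_half_factorial[OF hf] that by blast
  then have "\<exists>b\<in>carrier G. b \<otimes> a = \<one>" if "a \<in> carrier G" for a
    using that m_comm by metis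
  then have "comm_group G" by (intro comm_groupI) (auto simp: m_assoc intro: m_comm)
  then interpret G: comm_group G .
  show "group G" ..
  show "\<forall>x\<in>carrier G. finite_order G x"
  proof (rule ccontr)
    assume "\<not> (\<forall>x\<in>carrier G. finite_order G x)"
    then obtain x where x: "x \<in> carrier G" "\<And>n::nat. n > 0 \<Longrightarrow> x [^] n \<noteq> \<one>"
      using finite_order_iff by blast
    obtain P where P: "submonoid P G" "x \<in> P" "inv x \<notin> P"
      and total: "\<And>g. g \<in> carrier G \<Longrightarrow> g \<in> P \<or> inv g \<in> P"
      using G.total_submonoid_exists[OF x] by blast
    have "\<exists>p\<in>P. \<exists>q\<in>P. m \<otimes> q = p" if m: "m \<in> carrier G" for m
    proof (cases "m \<in> P")
      case True
      then show ?thesis using m submonoid.one_closed[OF P(1)] by force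
    next
      case False
      then show ?thesis using m total[OF m] submonoid.one_closed[OF P(1)] G.r_inv by blast
    qed
    then obtain b where "b \<in> P" "x \<otimes> b = \<one>"
      using all_Units_if_undermonoids_half_factorial[OF hf P(1) _ P(2)] by blast
    moreover have "b \<in> carrier G" using \<open>b \<in> P\<close> submonoid.subset[OF P(1)] by blast
    ultimately show False using P(3) x G.inv_equality by (metis m_comm)
  qed
qed

theorem theorem6p2:
  fixes M :: "('a, 'm) monoid_scheme"
  assumes "comm_monoid_cancel M"
  shows "((\<forall>N. submonoid N M \<longrightarrow> half_factorial (M\<lparr>carrier := N\<rparr>)) \<longleftrightarrow>
          (\<forall>N. undermonoid N M \<longrightarrow> half_factorial (M\<lparr>carrier := N\<rparr>)))
       \<and> ((\<forall>N. undermonoid N M \<longrightarrow> half_factorial (M\<lparr>carrier := N\<rparr>)) \<longleftrightarrow>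
          (group M \<and> (\<forall>x \<in> carrier M. finite_order M x)))"
proof -
  interpret comm_monoid_cancel M by (rule assms)
  have "undermonoid N M \<Longrightarrow> submonoid N M" for N by (simp add: undermonoid_def)
  then show ?thesis
    using submonoid_half_factorial_if_torsion torsion_group_if_undermonoids_half_factorial
    by meson
qed

end
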